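(* Let $G$ be a group, $\mathbf X$ a $G$-category, and $(X,\xi):G\to\mathbf X$ a fixed $1$-cocycle. The assignment $\varphi\mapsto\bigl(X,(\varphi(g)\xi_g)_{g\in G}\bigr)$ extends to a category isomorphism $Z^1(G,\mathrm{End}(X)_\xi)\cong Z^1(G,\mathbf X)_X$, and in particular $$H^1(G,\mathrm{Aut}(X)_\xi)=H^1(G,\mathrm{End}(X)_\xi)\cong H^1(G,\mathbf X)_X.$$
   Context: A $G$-category is a category $\mathbf X$ equipped with functors $g(-):\mathbf X\to\mathbf X$ ($g\in G$) such that $1(-)=1_{\mathbf X}$ and $(hg)(-)=h(-)\,g(-)$ (strict equalities). A $1$-cocycle $(X,\xi):G\to\mathbf X$ is an object $X$ with a family $\xi=(\xi_g)_{g\in G}$ of morphisms $\xi_g:g(X)\to X$ satisfying $\xi_1=1_X$ and $\xi_{hg}=\xi_h\,h(\xi_g)$ for all $g,h\in G$ (each $\xi_g$ is then an isomorphism). A morphism $f:(X,\xi)\to(X',\xi')$ is a morphism $f:X\to X'$ in $\mathbf X$ with $f\xi_g=\xi'_g\,g(f)$ for all $g$. This gives the category $Z^1(G,\mathbf X)$; $H^1(G,\mathbf X)$ is the set of isomorphism classes of its objects. For a fixed object $X$, $Z^1(G,\mathbf X)_X$ is the full subcategory of $Z^1(G,\mathbf X)$ on the $1$-cocycles with underlying object equal to $X$, and $H^1(G,\mathbf X)_X\subseteq H^1(G,\mathbf X)$ is the corresponding subset of isomorphism classes. For a $1$-cocycle $(X,\xi)$, $\mathrm{End}(X)_\xi$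 denotes the endomorphism monoid $\mathrm{End}(X)$ of $X$ in $\mathbf X$, regarded as a one-object category, with the $G$-category structure $ga=\xi_g\,g(a)\,(\xi_g)^{-1}$ for $g\in G$, $a\in\mathrm{End}(X)$; it restricts to a $G$-group structure on $\mathrm{Aut}(X)$, giving $\mathrm{Aut}(X)_\xi$, also regarded as a one-object $G$-category. Explicitly, an object of $Z^1(G,\mathrm{End}(X)_\xi)$ is a map $\varphi:G\to\mathrm{End}(X)$ with $\varphi(1)=1$ and $\varphi(hg)=\varphi(h)\cdot(h\varphi(g))$, and a morphism $\varphi\to\psi$ is an $a\in\mathrm{End}(X)$ with $a\varphi(g)=\psi(g)\cdot(ga)$ for all $g\in G$; similarly for $\mathrm{Aut}(X)_\xi$. *)

theory Defs
  imports "HOL-Algebra.Group"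
begin

section \<open>Categories and functors\<close>

record ('o, 'm) cat =
  Obj :: "'o set"
  Arr :: "'m set"
  Dom :: "'m \<Rightarrow> 'o"
  Cod :: "'m \<Rightarrow> 'o"
  Id :: "'o \<Rightarrow> 'm"
  Comp :: "'m \<Rightarrow> 'm \<Rightarrow> 'm" (infixl "\<cdot>\<index>" 70)

definition Hom :: "('o, 'm, 'z) cat_scheme \<Rightarrow> 'o \<Rightarrow> 'o \<Rightarrow> 'm set" where
  "Hom C a b = {f \<in> Arr C. Dom C f = a \<and> Cod C f = b}"

text \<open>Composition is written in the usual order: \<open>g \<cdot> f\<close> is ``first \<open>f\<close>, then \<open>g\<close>''.\<close>

locale category =
  fixes C :: "('o, 'm, 'z) cat_scheme" (structure)
  assumes Dom_closed: "f \<in> Arr C \<Longrightarrow> Dom C f \<in> Obj C"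
    and Cod_closed: "f \<in> Arr C \<Longrightarrow> Cod C f \<in> Obj C"
    and Id_closed: "a \<in> Obj C \<Longrightarrow> Id C a \<in> Hom C a a"
    and Comp_closed: "\<lbrakk>f \<in> Hom C a b; g \<in> Hom C b c\<rbrakk> \<Longrightarrow> g \<cdot> f \<in> Hom C a c"
    and Id_left: "f \<in> Hom C a b \<Longrightarrow> Id C b \<cdot> f = f"
    and Id_right: "f \<in> Hom C a b \<Longrightarrow> f \<cdot> Id C a = f"
    and Comp_assoc: "\<lbrakk>f \<in> Hom C a b; g \<in> Hom C b c; h \<in> Hom C c d\<rbrakk>
      \<Longrightarrow> (h \<cdot> g) \<cdot> f = h \<cdot> (g \<cdot> f)"

locale cat_functor = source: category A + target: category B
  for A :: "('o, 'm, 'z) cat_scheme" and B :: "('p, 'n, 'y) cat_scheme"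
    and FO :: "'o \<Rightarrow> 'p" and FA :: "'m \<Rightarrow> 'n" +
  assumes map_Obj: "a \<in> Obj A \<Longrightarrow> FO a \<in> Obj B"
    and map_Hom: "f \<in> Hom A a b \<Longrightarrow> FA f \<in> Hom B (FO a) (FO b)"
    and map_Id: "a \<in> Obj A \<Longrightarrow> FA (Id A a) = Id B (FO a)"
    and map_Comp: "\<lbrakk>f \<in> Hom A a b; g \<in> Hom A b c\<rbrakk>
      \<Longrightarrow> FA (g \<cdot>\<^bsub>A\<^esub> f) = FA g \<cdot>\<^bsub>B\<^esub> FA f"

definition cat_isomorphism ::
  "('o, 'm, 'z) cat_scheme \<Rightarrow> ('p, 'n, 'y) cat_scheme \<Rightarrow> ('o \<Rightarrow> 'p) \<Rightarrow> ('m \<Rightarrow> 'n) \<Rightarrow> bool" where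
  "cat_isomorphism A B FO FA \<longleftrightarrow> cat_functor A B FO FA \<and>
     (\<exists>KO KA. cat_functor B A KO KA \<and>
       (\<forall>a \<in> Obj A. KO (FO a) = a) \<and> (\<forall>f \<in> Arr A. KA (FA f) = f) \<and>
       (\<forall>b \<in> Obj B. FO (KO b) = b) \<and> (\<forall>g \<in> Arr B. FA (KA g) = g))"

definition inverse_arrows :: "('o, 'm, 'z) cat_scheme \<Rightarrow> 'm \<Rightarrow> 'm \<Rightarrow> bool" where
  "inverse_arrows C f h \<longleftrightarrow> f \<in> Arr C \<and> h \<in> Hom C (Cod C f) (Dom C f) \<and>
     h \<cdot>\<^bsub>C\<^esub> f = Id C (Dom C f) \<and> f \<cdot>\<^bsub>C\<^esub> h = Id C (Cod C f)"

definition inv_arrow :: "('o, 'm, 'z) cat_scheme \<Rightarrow> 'm \<Rightarrow> 'm" where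
  "inv_arrow C f = (THE h. inverse_arrows C f h)"

definition isomorphic :: "('o, 'm, 'z) cat_scheme \<Rightarrow> 'o \<Rightarrow> 'o \<Rightarrow> bool" where
  "isomorphic C a b \<longleftrightarrow> (\<exists>f \<in> Hom C a b. \<exists>h. inverse_arrows C f h)"

definition iso_class :: "('o, 'm, 'z) cat_scheme \<Rightarrow> 'o \<Rightarrow> 'o set" where
  "iso_class C a = {b \<in> Obj C. isomorphic C a b}"

definition full_subcategory :: "('o, 'm, 'z) cat_scheme \<Rightarrow> 'o set \<Rightarrow> ('o, 'm) cat" where
  "full_subcategory C S =
     \<lparr>Obj = Obj C \<inter> S,
      Arr = {f \<in> Arr C. Dom C f \<in> S \<and> Cod C f \<in> S},
      Dom = Dom C, Cod = Cod C, Id = Id C, Comp = Comp C\<rparr>"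


section \<open>Categories with a strict action of a group\<close>

record ('g, 'o, 'm) gcat = "('o, 'm) cat" +
  actO :: "'g \<Rightarrow> 'o \<Rightarrow> 'o"
  actA :: "'g \<Rightarrow> 'm \<Rightarrow> 'm"

locale G_category = group G + category C
  for G :: "('g, 'y) monoid_scheme" (structure)
    and C :: "('g, 'o, 'm, 'z) gcat_scheme" +
  assumes act_functor: "g \<in> carrier G \<Longrightarrow> cat_functor C C (actO C g) (actA C g)"
    and actO_one: "a \<in> Obj C \<Longrightarrow> actO C \<one> a = a"
    and actA_one: "f \<in> Arr C \<Longrightarrow> actA C \<one> f = f"
    and actO_mult: "\<lbrakk>h \<in> carrier G; g \<in> carrier G; a \<in> Obj C\<rbrakk>
      \<Longrightarrow> actO C (h \<otimes> g) a = actO C h (actO C g a)"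
    and actA_mult: "\<lbrakk>h \<in> carrier G; g \<in> carrier G; f \<in> Arr C\<rbrakk>
      \<Longrightarrow> actA C (h \<otimes> g) f = actA C h (actA C g f)"


section \<open>1-cocycles\<close>

text \<open>
  The families \<open>\<xi>\<close> are extensional (\<open>undefined\<close> outside \<open>carrier G\<close>), so that equality of
  functions is equality of families indexed by \<open>G\<close>.
\<close>

definition cocycles ::
  "('g, 'y) monoid_scheme \<Rightarrow> ('g, 'o, 'm, 'z) gcat_scheme \<Rightarrow> ('o \<times> ('g \<Rightarrow> 'm)) set" where
  "cocycles G C = {(X, \<xi>). X \<in> Obj C \<and>
     \<xi> \<in> (\<Pi>\<^sub>E g \<in> carrier G. Hom C (actO C g X) X) \<and>
     \<xi> \<one>\<^bsub>G\<^esub> = Id C X \<and>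
     (\<forall>h \<in> carrier G. \<forall>g \<in> carrier G. \<xi> (h \<otimes>\<^bsub>G\<^esub> g) = \<xi> h \<cdot>\<^bsub>C\<^esub> actA C h (\<xi> g))}"

definition cocycle_maps ::
  "('g, 'y) monoid_scheme \<Rightarrow> ('g, 'o, 'm, 'z) gcat_scheme \<Rightarrow>
   'o \<times> ('g \<Rightarrow> 'm) \<Rightarrow> 'o \<times> ('g \<Rightarrow> 'm) \<Rightarrow> 'm set" where
  "cocycle_maps G C = (\<lambda>(X, \<xi>) (X', \<xi>').
     {f \<in> Hom C X X'. \<forall>g \<in> carrier G. f \<cdot>\<^bsub>C\<^esub> \<xi> g = \<xi>' g \<cdot>\<^bsub>C\<^esub> actA C g f})"

text \<open>
  One underlying morphism \<open>f\<close> may be a morphism between several pairs of 1-cocycles; an arrow of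
  \<open>Z1\<close> is therefore a triple (source, \<open>f\<close>, target).
\<close>

definition Z1 ::
  "('g, 'y) monoid_scheme \<Rightarrow> ('g, 'o, 'm, 'z) gcat_scheme \<Rightarrow>
   ('o \<times> ('g \<Rightarrow> 'm), ('o \<times> ('g \<Rightarrow> 'm)) \<times> 'm \<times> ('o \<times> ('g \<Rightarrow> 'm))) cat" where
  "Z1 G C =
     \<lparr>Obj = cocycles G C,
      Arr = {(P, f, Q). P \<in> cocycles G C \<and> Q \<in> cocycles G C \<and> f \<in> cocycle_maps G C P Q},
      Dom = (\<lambda>(P, f, Q). P),
      Cod = (\<lambda>(P, f, Q). Q),
      Id = (\<lambda>P. (P, Id C (fst P), P)),
      Comp = (\<lambda>(Q', f', R) (P, f, Q). (P, f' \<cdot>\<^bsub>C\<^esub> f, R))\<rparr>"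

definition H1 ::
  "('g, 'y) monoid_scheme \<Rightarrow> ('g, 'o, 'm, 'z) gcat_scheme \<Rightarrow> ('o \<times> ('g \<Rightarrow> 'm)) set set" where
  "H1 G C = iso_class (Z1 G C) ` Obj (Z1 G C)"

definition Z1_at ::
  "('g, 'y) monoid_scheme \<Rightarrow> ('g, 'o, 'm, 'z) gcat_scheme \<Rightarrow> 'o \<Rightarrow>
   ('o \<times> ('g \<Rightarrow> 'm), ('o \<times> ('g \<Rightarrow> 'm)) \<times> 'm \<times> ('o \<times> ('g \<Rightarrow> 'm))) cat" where
  "Z1_at G C X = full_subcategory (Z1 G C) {P. fst P = X}"

text \<open>
  The elements of \<open>H1_at G C X\<close> are isomorphism classes in the whole of \<open>Z1 G C\<close>, namely those
  having a representative with underlying object \<open>X\<close>.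
\<close>

definition H1_at ::
  "('g, 'y) monoid_scheme \<Rightarrow> ('g, 'o, 'm, 'z) gcat_scheme \<Rightarrow> 'o \<Rightarrow> ('o \<times> ('g \<Rightarrow> 'm)) set set" where
  "H1_at G C X = iso_class (Z1 G C) ` Obj (Z1_at G C X)"


section \<open>The twisted endomorphism monoid and automorphism group\<close>

definition End_monoid :: "('o, 'm, 'z) cat_scheme \<Rightarrow> 'o \<Rightarrow> 'm monoid" where
  "End_monoid C X = \<lparr>carrier = Hom C X X, mult = Comp C, one = Id C X\<rparr>"

definition one_object_gcat ::
  "('m, 'y) monoid_scheme \<Rightarrow> ('g \<Rightarrow> 'm \<Rightarrow> 'm) \<Rightarrow> ('g, unit, 'm) gcat" where
  "one_object_gcat M act =
     \<lparr>Obj = {()}, Arr = carrier M, Dom = (\<lambda>_. ()), Cod = (\<lambda>_. ()),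
      Id = (\<lambda>_. one M), Comp = mult M,
      actO = (\<lambda>_ _. ()), actA = act\<rparr>"

definition twisted_act ::
  "('g, 'o, 'm, 'z) gcat_scheme \<Rightarrow> ('g \<Rightarrow> 'm) \<Rightarrow> 'g \<Rightarrow> 'm \<Rightarrow> 'm" where
  "twisted_act C \<xi> g a = \<xi> g \<cdot>\<^bsub>C\<^esub> actA C g a \<cdot>\<^bsub>C\<^esub> inv_arrow C (\<xi> g)"

definition End_twisted ::
  "('g, 'o, 'm, 'z) gcat_scheme \<Rightarrow> 'o \<Rightarrow> ('g \<Rightarrow> 'm) \<Rightarrow> ('g, unit, 'm) gcat" where
  "End_twisted C X \<xi> = one_object_gcat (End_monoid C X) (twisted_act C \<xi>)"

definition Aut_twisted ::
  "('g, 'o, 'm, 'z) gcat_scheme \<Rightarrow> 'o \<Rightarrow> ('g \<Rightarrow> 'm) \<Rightarrow> ('g, unit, 'm) gcat" where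
  "Aut_twisted C X \<xi> = one_object_gcat (units_of (End_monoid C X)) (twisted_act C \<xi>)"

text \<open>
  The assignment \<open>\<phi> \<mapsto> (X, (\<phi>(g) \<xi>\<^sub>g)\<^sub>g)\<close>. The first component of a 1-cocycle with values in a
  one-object category is \<open>()\<close> and carries no information.
\<close>

definition twist_cocycle ::
  "('g, 'y) monoid_scheme \<Rightarrow> ('o, 'm, 'z) cat_scheme \<Rightarrow> 'o \<Rightarrow> ('g \<Rightarrow> 'm) \<Rightarrow>
   unit \<times> ('g \<Rightarrow> 'm) \<Rightarrow> 'o \<times> ('g \<Rightarrow> 'm)" where
  "twist_cocycle G C X \<xi> = (\<lambda>(_, \<phi>). (X, \<lambda>g \<in> carrier G. \<phi> g \<cdot>\<^bsub>C\<^esub> \<xi> g))"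

end

theory Submission
  imports Defs
begin

text \<open>
  The value \<open>g a\<close> of the twisted action is the unique endomorphism \<open>t\<close> of \<open>X\<close> with
  \<open>t \<xi>\<^sub>g = \<xi>\<^sub>g g(a)\<close>. Hence, after right multiplication by the isomorphism \<open>\<xi>\<^sub>g\<close>, the equation
  defining morphisms \<open>\<phi> \<rightarrow> \<psi>\<close> over \<open>End(X)\<^sub>\<xi>\<close> becomes the one defining morphisms between the
  twisted cocycles, with the same underlying arrow; the cocycle equations are matched in the
  same way after multiplication by \<open>\<xi>\<^sub>h\<^sub>g = \<xi>\<^sub>h h(\<xi>\<^sub>g)\<close>. As all components of a 1-cocycle are
  invertible, 1-cocycles in \<open>End(X)\<^sub>\<xi>\<close> take values in \<open>Aut(X)\<close>, and isomorphisms between them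
  lie in \<open>Aut(X)\<close> too.
\<close>

section \<open>Isomorphisms in categories\<close>

lemma HomD:
  assumes "f \<in> Hom C a b"
  shows "f \<in> Arr C" "Dom C f = a" "Cod C f = b"
  using assms by (auto simp: Hom_def)

lemma inverse_arrows_iff:
  assumes "f \<in> Hom C a b"
  shows "inverse_arrows C f h \<longleftrightarrow>
    h \<in> Hom C b a \<and> h \<cdot>\<^bsub>C\<^esub> f = Id C a \<and> f \<cdot>\<^bsub>C\<^esub> h = Id C b"
  using assms by (auto simp: inverse_arrows_def Hom_def)

lemma isomorphic_iff:
  "isomorphic C a b \<longleftrightarrow> (\<exists>f \<in> Hom C a b. \<exists>h \<in> Hom C b a. h \<cdot>\<^bsub>C\<^esub> f = Id C a \<and> f \<cdot>\<^bsub>C\<^esub> h = Id C b)"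
  unfolding isomorphic_def by (meson inverse_arrows_iff)

context category
begin

lemma Hom_Obj:
  assumes "f \<in> Hom C a b"
  shows "a \<in> Obj C" "b \<in> Obj C"
  using assms Dom_closed Cod_closed by (auto simp: Hom_def)

text \<open>\<open>inv_arrow\<close> is a definite description, so it denotes an inverse only
  because inverses are unique: k = k(fh) = (kf)h = h.\<close>

lemma inv_arrow_eq:
  assumes f: "f \<in> Hom C a b" and h: "inverse_arrows C f h"
  shows "inv_arrow C f = h"
  unfolding inv_arrow_def
proof (rule the_equality)
  show "inverse_arrows C f h" by (rule h)
next
  fix k assume k: "inverse_arrows C f k"
  have "k = k \<cdot> (f \<cdot> h)"
    using Id_right h k by (auto simp: inverse_arrows_iff[OF f])
  also have "\<dots> = (k \<cdot> f) \<cdot> h"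
    using f h k by (intro Comp_assoc[symmetric]) (auto simp: inverse_arrows_iff)
  also have "\<dots> = h"
    using Id_left h k by (auto simp: inverse_arrows_iff[OF f])
  finally show "k = h" .
qed

lemma comp_inverse_cancel:
  assumes "f \<in> Hom C a b" "inverse_arrows C f h" "x \<in> Hom C a c"
  shows "(x \<cdot> h) \<cdot> f = x"
  using assms Comp_assoc[of f a b h a x c] by (simp add: inverse_arrows_iff Id_right)

lemma comp_iso_cancel:
  assumes "f \<in> Hom C a b" "inverse_arrows C f h" "x \<in> Hom C b c"
  shows "(x \<cdot> f) \<cdot> h = x"
  using assms Comp_assoc[of h b a f b x c] by (simp add: inverse_arrows_iff Id_right)

lemma iso_right_cancel:
  assumes "f \<in> Hom C a b" "inverse_arrows C f h" "x \<in> Hom C b c" "y \<in> Hom C b c"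
  shows "x \<cdot> f = y \<cdot> f \<longleftrightarrow> x = y"
  using assms comp_iso_cancel by metis

lemma isomorphic_refl:
  assumes "a \<in> Obj C"
  shows "isomorphic C a a"
  unfolding isomorphic_iff using assms Id_closed Id_left by blast

lemma isomorphic_sym:
  assumes "isomorphic C a b"
  shows "isomorphic C b a"
  using assms unfolding isomorphic_iff by blast

lemma isomorphic_trans:
  assumes "isomorphic C a b" "isomorphic C b c"
  shows "isomorphic C a c"
proof -
  obtain f f' where f: "f \<in> Hom C a b" "f' \<in> Hom C b a" "f' \<cdot> f = Id C a" "f \<cdot> f' = Id C b"
    using assms(1) unfolding isomorphic_iff by blast
  obtain k k' where k: "k \<in> Hom C b c" "k' \<in> Hom C c b" "k' \<cdot> k = Id C b" "k \<cdot> k' = Id C c"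
    using assms(2) unfolding isomorphic_iff by blast
  have "(f' \<cdot> k') \<cdot> (k \<cdot> f) = f' \<cdot> ((k' \<cdot> k) \<cdot> f)"
    using Comp_assoc[OF Comp_closed[OF f(1) k(1)] k(2) f(2)] Comp_assoc[OF f(1) k(1,2)] by simp
  moreover have "(k \<cdot> f) \<cdot> (f' \<cdot> k') = k \<cdot> ((f \<cdot> f') \<cdot> k')"
    using Comp_assoc[OF Comp_closed[OF k(2) f(2)] f(1) k(1)] Comp_assoc[OF k(2) f(2,1)] by simp
  moreover have "k \<cdot> f \<in> Hom C a c" "f' \<cdot> k' \<in> Hom C c a"
    using f k by (auto intro: Comp_closed)
  ultimately show ?thesis
    unfolding isomorphic_iff using f k by (metis Id_left)
qed

lemma iso_class_eq_iff:
  assumes "a \<in> Obj C" "b \<in> Obj C"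
  shows "iso_class C a = iso_class C b \<longleftrightarrow> isomorphic C a b"
  using assms isomorphic_refl isomorphic_sym isomorphic_trans
  unfolding iso_class_def by blast

lemma category_full_subcategory: "category (full_subcategory C S)"
proof -
  have *: "f \<in> Hom (full_subcategory C S) a b \<longleftrightarrow> f \<in> Hom C a b \<and> a \<in> S \<and> b \<in> S" for f a b
    by (auto simp: full_subcategory_def Hom_def)
  show ?thesis
    by unfold_locales
      (auto simp: * intro: Id_closed Comp_closed Id_left Id_right Comp_assoc,
       auto simp: full_subcategory_def intro: Dom_closed Cod_closed Id_closed Comp_closed
         Id_left Id_right Comp_assoc)
qed

end

section \<open>Comparing isomorphism classes and inverting functors\<close>

text \<open>Preserving isomorphism makes the induced map on classes well defined, reflecting it
  makes the map injective. The target consists of classes taken in the whole of \<open>B\<close> of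
  objects in the image of \<open>F\<close>, which is the shape of \<open>H1_at\<close>.\<close>

lemma bij_betw_iso_classes:
  assumes "category A" "category B"
    and F: "\<And>a. a \<in> Obj A \<Longrightarrow> F a \<in> Obj B"
    and iso: "\<And>a b. \<lbrakk>a \<in> Obj A; b \<in> Obj A\<rbrakk> \<Longrightarrow> isomorphic B (F a) (F b) \<longleftrightarrow> isomorphic A a b"
  obtains \<Phi> where "bij_betw \<Phi> (iso_class A ` Obj A) (iso_class B ` F ` Obj A)"
    and "\<And>a. a \<in> Obj A \<Longrightarrow> \<Phi> (iso_class A a) = iso_class B (F a)"
proof -
  interpret A: category A by fact
  interpret B: category B by fact
  \<comment> \<open>A class is a bare set of objects, so a representative is chosen;
    \<open>eq\<close> makes the value independent of the choice.\<close>
  define \<Phi> where "\<Phi> c = iso_class B (F (SOME a. a \<in> Obj A \<and> iso_class A a = c))" for c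
  have eq: "iso_class B (F a) = iso_class B (F b) \<longleftrightarrow> iso_class A a = iso_class A b"
    if "a \<in> Obj A" "b \<in> Obj A" for a b
    using that by (simp add: A.iso_class_eq_iff B.iso_class_eq_iff F iso)
  have \<Phi>: "\<Phi> (iso_class A a) = iso_class B (F a)" if "a \<in> Obj A" for a
  proof -
    define b where "b = (SOME b. b \<in> Obj A \<and> iso_class A b = iso_class A a)"
    have "b \<in> Obj A \<and> iso_class A b = iso_class A a"
      unfolding b_def by (rule someI[of _ a]) (simp add: that)
    then show ?thesis
      using eq that unfolding \<Phi>_def b_def[symmetric] by blast
  qed
  have "bij_betw \<Phi> (iso_class A ` Obj A) (iso_class B ` F ` Obj A)"
    unfolding bij_betw_def inj_on_def by (auto simp: \<Phi> eq image_image)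
  with \<Phi> that show thesis by blast
qed

text \<open>The inverse maps on objects and arrows form a functor: each arrow of \<open>B\<close>
  lifts uniquely to \<open>A\<close>, and the endpoints of the lift are recovered from those of the
  arrow by injectivity on objects.\<close>

lemma cat_functor_bij_imp_isomorphism:
  assumes "cat_functor A B FO FA"
    and O: "bij_betw FO (Obj A) (Obj B)" and M: "bij_betw FA (Arr A) (Arr B)"
  shows "cat_isomorphism A B FO FA"
proof -
  interpret cat_functor A B FO FA by fact
  define KO where "KO = the_inv_into (Obj A) FO"
  define KA where "KA = the_inv_into (Arr A) FA"
  have KO_FO: "KO (FO a) = a" if "a \<in> Obj A" for a
    using that O unfolding KO_def bij_betw_def by (simp add: the_inv_into_f_f)
  have KA_FA: "KA (FA f) = f" if "f \<in> Arr A" for f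
    using that M unfolding KA_def bij_betw_def by (simp add: the_inv_into_f_f)
  have ObjE: "\<exists>a \<in> Obj A. b = FO a" if "b \<in> Obj B" for b
    using that O unfolding bij_betw_def by blast
  have HomE: "\<exists>a b f. a \<in> Obj A \<and> b \<in> Obj A \<and> f \<in> Hom A a b \<and> c = FO a \<and> d = FO b \<and> g = FA f"
    if g: "g \<in> Hom B c d" for g c d
  proof -
    obtain f where f: "f \<in> Arr A" "g = FA f"
      using HomD(1)[OF g] M unfolding bij_betw_def by blast
    have "f \<in> Hom A (Dom A f) (Cod A f)"
      using f by (simp add: Hom_def)
    with f g show ?thesis
      using map_Hom source.Hom_Obj HomD by metis
  qed
  have "cat_functor B A KO KA"
  proof
    fix b assume "b \<in> Obj B"
    then show "KO b \<in> Obj A" using ObjE KO_FO by metis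
  next
    fix f a b assume "f \<in> Hom B a b"
    then show "KA f \<in> Hom A (KO a) (KO b)" using HomE KO_FO KA_FA HomD(1) by metis
  next
    fix b assume "b \<in> Obj B"
    then obtain a where a: "a \<in> Obj A" "b = FO a" using ObjE by blast
    then have "Id B b = FA (Id A a)" by (simp add: map_Id)
    then show "KA (Id B b) = Id A (KO b)"
      using a KA_FA KO_FO HomD(1) source.Id_closed by metis
  next
    fix f g a b c assume f: "f \<in> Hom B a b" and g: "g \<in> Hom B b c"
    obtain p q f' where f': "p \<in> Obj A" "q \<in> Obj A" "f' \<in> Hom A p q" "b = FO q" "f = FA f'"
      using HomE[OF f] by blast
    obtain q' r g' where g': "q' \<in> Obj A" "g' \<in> Hom A q' r" "b = FO q'" "g = FA g'"
      using HomE[OF g] by blast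
    \<comment> \<open>Composability in \<open>B\<close> only says that the middle objects of the two
      lifts have the same image; injectivity of \<open>FO\<close> makes the lifts composable in
      \<open>A\<close>.\<close>
    have "q' = q" using f' g' KO_FO by metis
    then have "g' \<cdot>\<^bsub>A\<^esub> f' \<in> Hom A p r" "g \<cdot>\<^bsub>B\<^esub> f = FA (g' \<cdot>\<^bsub>A\<^esub> f')"
      using f' g' source.Comp_closed map_Comp by auto
    then show "KA (g \<cdot>\<^bsub>B\<^esub> f) = KA g \<cdot>\<^bsub>A\<^esub> KA f"
      using f' g' KA_FA HomD(1) by metis
  qed
  moreover have "FO (KO b) = b" if "b \<in> Obj B" for b
    using ObjE[OF that] KO_FO by auto
  moreover have "FA (KA g) = g" if "g \<in> Arr B" for g
    using that M KA_FA unfolding bij_betw_def by (metis imageE)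
  ultimately show ?thesis
    unfolding cat_isomorphism_def using assms(1) KO_FO KA_FA by blast
qed

section \<open>The category of 1-cocycles\<close>

lemma cocycles_iff:
  "(X, \<xi>) \<in> cocycles G C \<longleftrightarrow> X \<in> Obj C \<and>
     \<xi> \<in> (\<Pi>\<^sub>E g \<in> carrier G. Hom C (actO C g X) X) \<and> \<xi> \<one>\<^bsub>G\<^esub> = Id C X \<and>
     (\<forall>h \<in> carrier G. \<forall>g \<in> carrier G. \<xi> (h \<otimes>\<^bsub>G\<^esub> g) = \<xi> h \<cdot>\<^bsub>C\<^esub> actA C h (\<xi> g))"
  by (simp add: cocycles_def)

lemma cocycle_maps_iff:
  "f \<in> cocycle_maps G C P Q \<longleftrightarrow> f \<in> Hom C (fst P) (fst Q) \<and>
     (\<forall>g \<in> carrier G. f \<cdot>\<^bsub>C\<^esub> snd P g = snd Q g \<cdot>\<^bsub>C\<^esub> actA C g f)"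
  by (auto simp: cocycle_maps_def split: prod.splits)

lemma Obj_Z1: "Obj (Z1 G C) = cocycles G C"
  by (simp add: Z1_def)

lemma Hom_Z1_iff:
  "F \<in> Hom (Z1 G C) P Q \<longleftrightarrow> P \<in> cocycles G C \<and> Q \<in> cocycles G C \<and>
     (\<exists>f \<in> cocycle_maps G C P Q. F = (P, f, Q))"
  by (auto simp: Z1_def Hom_def)

lemma Id_Z1: "Id (Z1 G C) P = (P, Id C (fst P), P)"
  by (simp add: Z1_def)

lemma Comp_Z1: "(Q', f', R) \<cdot>\<^bsub>Z1 G C\<^esub> (P, f, Q) = (P, f' \<cdot>\<^bsub>C\<^esub> f, R)"
  by (simp add: Z1_def)

text \<open>Strips the source and target tags from arrows of \<open>Z1\<close>, so that isomorphism
  over different coefficient categories can be compared through underlying arrows alone.\<close>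

lemma isomorphic_Z1_iff:
  "isomorphic (Z1 G C) P Q \<longleftrightarrow> P \<in> cocycles G C \<and> Q \<in> cocycles G C \<and>
     (\<exists>f \<in> cocycle_maps G C P Q. \<exists>h \<in> cocycle_maps G C Q P.
        h \<cdot>\<^bsub>C\<^esub> f = Id C (fst P) \<and> f \<cdot>\<^bsub>C\<^esub> h = Id C (fst Q))"
  (is "_ \<longleftrightarrow> ?rhs")
proof
  assume "isomorphic (Z1 G C) P Q"
  then show ?rhs
    unfolding isomorphic_iff by (fastforce simp: Hom_Z1_iff Id_Z1 Comp_Z1)
next
  assume ?rhs
  then obtain f h where "(P, f, Q) \<in> Hom (Z1 G C) P Q" "(Q, h, P) \<in> Hom (Z1 G C) Q P"
    and "h \<cdot>\<^bsub>C\<^esub> f = Id C (fst P)" "f \<cdot>\<^bsub>C\<^esub> h = Id C (fst Q)"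
    by (auto simp: Hom_Z1_iff)
  then show "isomorphic (Z1 G C) P Q"
    unfolding isomorphic_iff by (metis Comp_Z1 Id_Z1)
qed

section \<open>Invertibility of cocycle components and the category axioms\<close>

context G_category
begin

lemma act_Hom:
  assumes "g \<in> carrier G" "f \<in> Hom C a b"
  shows "actA C g f \<in> Hom C (actO C g a) (actO C g b)"
  using act_functor[OF assms(1)] assms(2) by (rule cat_functor.map_Hom)

lemma act_Id:
  assumes "g \<in> carrier G" "a \<in> Obj C"
  shows "actA C g (Id C a) = Id C (actO C g a)"
  using act_functor[OF assms(1)] assms(2) by (rule cat_functor.map_Id)

lemma act_Comp:
  assumes "g \<in> carrier G" "f \<in> Hom C a b" "k \<in> Hom C b c"
  shows "actA C g (k \<cdot>\<^bsub>C\<^esub> f) = actA C g k \<cdot>\<^bsub>C\<^esub> actA C g f"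
  using act_functor[OF assms(1)] assms(2,3) by (rule cat_functor.map_Comp)

lemma cocycle_Hom:
  assumes "(X, \<xi>) \<in> cocycles G C" "g \<in> carrier G"
  shows "\<xi> g \<in> Hom C (actO C g X) X"
  using assms by (auto simp: cocycles_iff)

text \<open>The cocycle equation for the pair (g, \<open>inv g\<close>) gives one inverse law
  directly. The pair (\<open>inv g\<close>, g) gives an equation on which g must still act;
  strictness of the action then turns it into the other law.\<close>

lemma cocycle_inverse:
  assumes \<xi>: "(X, \<xi>) \<in> cocycles G C" and g: "g \<in> carrier G"
  shows "inverse_arrows C (\<xi> g) (actA C g (\<xi> (inv g)))"
proof -
  have X: "X \<in> Obj C" using \<xi> by (simp add: cocycles_iff)
  have one: "\<xi> \<one> = Id C X" using \<xi> by (simp add: cocycles_iff)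
  have mult: "\<xi> (h \<otimes> k) = \<xi> h \<cdot>\<^bsub>C\<^esub> actA C h (\<xi> k)" if "h \<in> carrier G" "k \<in> carrier G" for h k
    using \<xi> that by (simp add: cocycles_iff)
  note \<xi>g = cocycle_Hom[OF \<xi> g]
  note \<xi>i = cocycle_Hom[OF \<xi> inv_closed[OF g]]
  \<comment> \<open>Strictness is what gives the candidate inverse the domain X.\<close>
  have act_inv: "actO C g (actO C (inv g) X) = X"
    using g X actO_mult[of g "inv g" X] actO_one by simp
  have i: "actA C g (\<xi> (inv g)) \<in> Hom C X (actO C g X)"
    using act_Hom[OF g \<xi>i] act_inv by simp
  have "actA C (inv g) (\<xi> g) \<in> Hom C (actO C (inv g) (actO C g X)) (actO C (inv g) X)"
    using g by (intro act_Hom \<xi>g) auto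
  then have "actA C g (\<xi> (inv g) \<cdot>\<^bsub>C\<^esub> actA C (inv g) (\<xi> g))
      = actA C g (\<xi> (inv g)) \<cdot>\<^bsub>C\<^esub> actA C g (actA C (inv g) (\<xi> g))"
    using g \<xi>i by (intro act_Comp)
  moreover have "\<xi> (inv g) \<cdot>\<^bsub>C\<^esub> actA C (inv g) (\<xi> g) = Id C X"
    using mult[of "inv g" g] one g by simp
  moreover have "actA C g (actA C (inv g) (\<xi> g)) = \<xi> g"
    using g \<xi>g actA_mult[of g "inv g" "\<xi> g"] actA_one HomD(1) by fastforce
  ultimately have "actA C g (\<xi> (inv g)) \<cdot>\<^bsub>C\<^esub> \<xi> g = Id C (actO C g X)"
    using act_Id[OF g X] by simp
  moreover have "\<xi> g \<cdot>\<^bsub>C\<^esub> actA C g (\<xi> (inv g)) = Id C X"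
    using mult[of g "inv g"] one g by simp
  ultimately show ?thesis
    using i by (simp add: inverse_arrows_iff[OF \<xi>g])
qed

lemma Id_cocycle_map:
  assumes "P \<in> cocycles G C"
  shows "Id C (fst P) \<in> cocycle_maps G C P P"
proof -
  obtain X \<xi> where P: "P = (X, \<xi>)" by fastforce
  then have "X \<in> Obj C" using assms by (simp add: cocycles_iff)
  then show ?thesis
    using cocycle_Hom assms unfolding P
    by (auto simp: cocycle_maps_iff act_Id Id_closed intro!: Id_left[THEN trans] Id_right[symmetric])
qed

text \<open>The commuting squares of f and k are pasted along \<open>snd Q g\<close>; functoriality
  of g merges the two arrows on the acted side.\<close>

lemma Comp_cocycle_map:
  assumes PQR: "P \<in> cocycles G C" "Q \<in> cocycles G C" "R \<in> cocycles G C"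
    and f: "f \<in> cocycle_maps G C P Q" and k: "k \<in> cocycle_maps G C Q R"
  shows "k \<cdot>\<^bsub>C\<^esub> f \<in> cocycle_maps G C P R"
proof -
  have fH: "f \<in> Hom C (fst P) (fst Q)" and kH: "k \<in> Hom C (fst Q) (fst R)"
    using f k by (auto simp: cocycle_maps_iff)
  have "(k \<cdot>\<^bsub>C\<^esub> f) \<cdot>\<^bsub>C\<^esub> snd P g = snd R g \<cdot>\<^bsub>C\<^esub> actA C g (k \<cdot>\<^bsub>C\<^esub> f)" if g: "g \<in> carrier G" for g
  proof -
    have hom: "snd P g \<in> Hom C (actO C g (fst P)) (fst P)"
      "snd Q g \<in> Hom C (actO C g (fst Q)) (fst Q)"
      "snd R g \<in> Hom C (actO C g (fst R)) (fst R)"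
      using PQR g by (auto intro!: cocycle_Hom)
    have gf: "actA C g f \<in> Hom C (actO C g (fst P)) (actO C g (fst Q))"
      and gk: "actA C g k \<in> Hom C (actO C g (fst Q)) (actO C g (fst R))"
      using g fH kH act_Hom by auto
    have "(k \<cdot>\<^bsub>C\<^esub> f) \<cdot>\<^bsub>C\<^esub> snd P g = k \<cdot>\<^bsub>C\<^esub> (f \<cdot>\<^bsub>C\<^esub> snd P g)"
      using hom fH kH by (intro Comp_assoc)
    also have "\<dots> = k \<cdot>\<^bsub>C\<^esub> (snd Q g \<cdot>\<^bsub>C\<^esub> actA C g f)"
      using f g by (simp add: cocycle_maps_iff)
    also have "\<dots> = (k \<cdot>\<^bsub>C\<^esub> snd Q g) \<cdot>\<^bsub>C\<^esub> actA C g f"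
      using hom gf kH by (intro Comp_assoc[symmetric])
    also have "\<dots> = (snd R g \<cdot>\<^bsub>C\<^esub> actA C g k) \<cdot>\<^bsub>C\<^esub> actA C g f"
      using k g by (simp add: cocycle_maps_iff)
    also have "\<dots> = snd R g \<cdot>\<^bsub>C\<^esub> (actA C g k \<cdot>\<^bsub>C\<^esub> actA C g f)"
      using hom gf gk by (intro Comp_assoc)
    also have "actA C g k \<cdot>\<^bsub>C\<^esub> actA C g f = actA C g (k \<cdot>\<^bsub>C\<^esub> f)"
      using g fH kH by (intro act_Comp[symmetric])
    finally show ?thesis .
  qed
  then show ?thesis
    using Comp_closed[OF fH kH] by (simp add: cocycle_maps_iff)
qed

lemma category_Z1: "category (Z1 G C)"
proof
  fix F assume "F \<in> Arr (Z1 G C)"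
  then show "Dom (Z1 G C) F \<in> Obj (Z1 G C)" "Cod (Z1 G C) F \<in> Obj (Z1 G C)"
    by (auto simp: Z1_def)
next
  fix P assume "P \<in> Obj (Z1 G C)"
  then show "Id (Z1 G C) P \<in> Hom (Z1 G C) P P"
    by (simp add: Hom_Z1_iff Id_Z1 Obj_Z1 Id_cocycle_map)
next
  fix F K P Q R assume "F \<in> Hom (Z1 G C) P Q" "K \<in> Hom (Z1 G C) Q R"
  then show "K \<cdot>\<^bsub>Z1 G C\<^esub> F \<in> Hom (Z1 G C) P R"
    by (auto simp: Hom_Z1_iff Comp_Z1 intro: Comp_cocycle_map)
next
  fix F P Q assume "F \<in> Hom (Z1 G C) P Q"
  then show "Id (Z1 G C) Q \<cdot>\<^bsub>Z1 G C\<^esub> F = F" "F \<cdot>\<^bsub>Z1 G C\<^esub> Id (Z1 G C) P = F"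
    by (auto simp: Hom_Z1_iff Id_Z1 Comp_Z1 cocycle_maps_iff intro: Id_left Id_right)
next
  fix F K L P Q R S
  assume "F \<in> Hom (Z1 G C) P Q" "K \<in> Hom (Z1 G C) Q R" "L \<in> Hom (Z1 G C) R S"
  then show "(L \<cdot>\<^bsub>Z1 G C\<^esub> K) \<cdot>\<^bsub>Z1 G C\<^esub> F = L \<cdot>\<^bsub>Z1 G C\<^esub> (K \<cdot>\<^bsub>Z1 G C\<^esub> F)"
    by (auto simp: Hom_Z1_iff Comp_Z1 cocycle_maps_iff intro: Comp_assoc)
qed

end

section \<open>Twisting by a 1-cocycle\<close>

lemma End_twisted_simps:
  "Obj (End_twisted C X \<xi>) = {()}"
  "Arr (End_twisted C X \<xi>) = Hom C X X"
  "Hom (End_twisted C X \<xi>) u v = Hom C X X"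
  "Id (End_twisted C X \<xi>) u = Id C X"
  "Comp (End_twisted C X \<xi>) = Comp C"
  "actO (End_twisted C X \<xi>) g u = ()"
  "actA (End_twisted C X \<xi>) = twisted_act C \<xi>"
  by (auto simp: End_twisted_def one_object_gcat_def End_monoid_def Hom_def)

lemma Aut_twisted_simps:
  "Obj (Aut_twisted C X \<xi>) = {()}"
  "Hom (Aut_twisted C X \<xi>) u v = Units (End_monoid C X)"
  "Id (Aut_twisted C X \<xi>) u = Id C X"
  "Comp (Aut_twisted C X \<xi>) = Comp C"
  "actO (Aut_twisted C X \<xi>) g u = ()"
  "actA (Aut_twisted C X \<xi>) = twisted_act C \<xi>"
  by (auto simp: Aut_twisted_def one_object_gcat_def End_monoid_def units_of_def Hom_def)

lemma Units_End_monoid_iff: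
  "a \<in> Units (End_monoid C X) \<longleftrightarrow>
     a \<in> Hom C X X \<and> (\<exists>b \<in> Hom C X X. b \<cdot>\<^bsub>C\<^esub> a = Id C X \<and> a \<cdot>\<^bsub>C\<^esub> b = Id C X)"
  by (auto simp: Units_def End_monoid_def)

section \<open>The twisted action on the endomorphism monoid\<close>

locale G_category_cocycle = G_category G C
  for G :: "('g, 'y) monoid_scheme" (structure)
    and C :: "('g, 'o, 'm, 'z) gcat_scheme" +
  fixes X :: 'o and \<xi> :: "'g \<Rightarrow> 'm"
  assumes cocycle: "(X, \<xi>) \<in> cocycles G C"
begin

abbreviation E where "E \<equiv> End_twisted C X \<xi>"
abbreviation twist where "twist \<equiv> twist_cocycle G C X \<xi>"

lemma X_Obj: "X \<in> Obj C"
  and \<xi>_one: "\<xi> \<one> = Id C X"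
  and \<xi>_mult: "\<lbrakk>h \<in> carrier G; g \<in> carrier G\<rbrakk> \<Longrightarrow> \<xi> (h \<otimes> g) = \<xi> h \<cdot>\<^bsub>C\<^esub> actA C h (\<xi> g)"
  using cocycle by (auto simp: cocycles_iff)

lemmas \<xi>_Hom = cocycle_Hom[OF cocycle]

text \<open>Since each \<open>\<xi> g\<close> is an isomorphism, identities between arrows out of X
  may be tested after composing with it. This is how the inverse in the definition of the twisted
  action is avoided from here on.\<close>

lemma \<xi>_cancel:
  assumes "g \<in> carrier G" "x \<in> Hom C X b" "y \<in> Hom C X b"
  shows "x \<cdot>\<^bsub>C\<^esub> \<xi> g = y \<cdot>\<^bsub>C\<^esub> \<xi> g \<longleftrightarrow> x = y"
  using iso_right_cancel[OF \<xi>_Hom cocycle_inverse[OF cocycle]] assms by simp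

text \<open>Existence of the inverse comes from \<open>cocycle_inverse\<close>, its agreement with
  the description from \<open>inv_arrow_eq\<close>.\<close>

lemma \<xi>_inv:
  assumes "g \<in> carrier G"
  shows "inverse_arrows C (\<xi> g) (inv_arrow C (\<xi> g))"
  using assms cocycle_inverse[OF cocycle] inv_arrow_eq[OF \<xi>_Hom] by metis

lemma \<xi>_inv_Hom:
  assumes "g \<in> carrier G"
  shows "inv_arrow C (\<xi> g) \<in> Hom C X (actO C g X)"
  using \<xi>_inv[OF assms] inverse_arrows_iff[OF \<xi>_Hom[OF assms]] by blast

lemma twisted_act_Hom:
  assumes "g \<in> carrier G" "a \<in> Hom C X X"
  shows "twisted_act C \<xi> g a \<in> Hom C X X"
  unfolding twisted_act_def
  using assms by (meson Comp_closed \<xi>_Hom \<xi>_inv_Hom act_Hom)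

lemma twisted_act_comp:
  assumes "g \<in> carrier G" "a \<in> Hom C X X"
  shows "twisted_act C \<xi> g a \<cdot>\<^bsub>C\<^esub> \<xi> g = \<xi> g \<cdot>\<^bsub>C\<^esub> actA C g a"
  unfolding twisted_act_def
  using assms by (meson comp_inverse_cancel Comp_closed \<xi>_Hom \<xi>_inv act_Hom)

text \<open>Both candidates have the same composite with \<open>\<xi> g\<close>, which cancels. The
  axioms of the twisted action are all verified through this characterisation.\<close>

lemma twisted_act_eqI:
  assumes "g \<in> carrier G" "a \<in> Hom C X X" "t \<in> Hom C X X"
    and "t \<cdot>\<^bsub>C\<^esub> \<xi> g = \<xi> g \<cdot>\<^bsub>C\<^esub> actA C g a"
  shows "twisted_act C \<xi> g a = t"
  using assms twisted_act_Hom twisted_act_comp \<xi>_cancel by metis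

text \<open>With b the value of a cocycle at g, this converts the right side of the morphism
  equation over \<open>E\<close> into the one for twisted cocycles.\<close>

lemma twisted_act_comp_left:
  assumes g: "g \<in> carrier G" and a: "a \<in> Hom C X X" and b: "b \<in> Hom C X X"
  shows "(b \<cdot>\<^bsub>C\<^esub> twisted_act C \<xi> g a) \<cdot>\<^bsub>C\<^esub> \<xi> g = (b \<cdot>\<^bsub>C\<^esub> \<xi> g) \<cdot>\<^bsub>C\<^esub> actA C g a"
proof -
  have "(b \<cdot>\<^bsub>C\<^esub> twisted_act C \<xi> g a) \<cdot>\<^bsub>C\<^esub> \<xi> g = b \<cdot>\<^bsub>C\<^esub> (twisted_act C \<xi> g a \<cdot>\<^bsub>C\<^esub> \<xi> g)"
    using g a b twisted_act_Hom \<xi>_Hom by (intro Comp_assoc)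
  also have "\<dots> = b \<cdot>\<^bsub>C\<^esub> (\<xi> g \<cdot>\<^bsub>C\<^esub> actA C g a)"
    using g a by (simp add: twisted_act_comp)
  also have "\<dots> = (b \<cdot>\<^bsub>C\<^esub> \<xi> g) \<cdot>\<^bsub>C\<^esub> actA C g a"
    using act_Hom[OF g a] \<xi>_Hom[OF g] b by (intro Comp_assoc[symmetric])
  finally show ?thesis .
qed

lemma twisted_act_one:
  assumes "a \<in> Hom C X X"
  shows "twisted_act C \<xi> \<one> a = a"
  using assms
  by (intro twisted_act_eqI) (simp_all add: \<xi>_one actA_one[OF HomD(1)] Id_left Id_right)

lemma twisted_act_Id:
  assumes "g \<in> carrier G"
  shows "twisted_act C \<xi> g (Id C X) = Id C X"
  using assms X_Obj \<xi>_Hom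
  by (intro twisted_act_eqI) (simp_all add: act_Id Id_closed Id_left[OF \<xi>_Hom] Id_right[OF \<xi>_Hom])

lemma twisted_act_Comp:
  assumes g: "g \<in> carrier G" and a: "a \<in> Hom C X X" and b: "b \<in> Hom C X X"
  shows "twisted_act C \<xi> g (b \<cdot>\<^bsub>C\<^esub> a) = twisted_act C \<xi> g b \<cdot>\<^bsub>C\<^esub> twisted_act C \<xi> g a"
proof (rule twisted_act_eqI[OF g])
  show "b \<cdot>\<^bsub>C\<^esub> a \<in> Hom C X X" "twisted_act C \<xi> g b \<cdot>\<^bsub>C\<^esub> twisted_act C \<xi> g a \<in> Hom C X X"
    using assms by (auto intro: Comp_closed twisted_act_Hom)
  have "(twisted_act C \<xi> g b \<cdot>\<^bsub>C\<^esub> twisted_act C \<xi> g a) \<cdot>\<^bsub>C\<^esub> \<xi> g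
      = (\<xi> g \<cdot>\<^bsub>C\<^esub> actA C g b) \<cdot>\<^bsub>C\<^esub> actA C g a"
    using assms by (simp add: twisted_act_comp_left twisted_act_Hom twisted_act_comp)
  also have "\<dots> = \<xi> g \<cdot>\<^bsub>C\<^esub> (actA C g b \<cdot>\<^bsub>C\<^esub> actA C g a)"
    using act_Hom[OF g a] act_Hom[OF g b] \<xi>_Hom[OF g] by (intro Comp_assoc)
  finally show "(twisted_act C \<xi> g b \<cdot>\<^bsub>C\<^esub> twisted_act C \<xi> g a) \<cdot>\<^bsub>C\<^esub> \<xi> g
      = \<xi> g \<cdot>\<^bsub>C\<^esub> actA C g (b \<cdot>\<^bsub>C\<^esub> a)"
    using act_Comp[OF assms] by simp
qed

lemma comp_\<xi>_mult:
  assumes h: "h \<in> carrier G" and g: "g \<in> carrier G" and b: "b \<in> Hom C X X"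
  shows "b \<cdot>\<^bsub>C\<^esub> \<xi> (h \<otimes> g) = (b \<cdot>\<^bsub>C\<^esub> \<xi> h) \<cdot>\<^bsub>C\<^esub> actA C h (\<xi> g)"
  using Comp_assoc[OF act_Hom[OF h \<xi>_Hom[OF g]] \<xi>_Hom[OF h] b] \<xi>_mult[OF h g] by simp

text \<open>The central computation. For b = \<phi>(h) and a = \<phi>(g) it matches the cocycle
  equation over \<open>E\<close> with that of the twisted family; for b = 1 it yields
  multiplicativity of the twisted action.\<close>

lemma twisted_act_comp_\<xi>_mult:
  assumes h: "h \<in> carrier G" and g: "g \<in> carrier G"
    and a: "a \<in> Hom C X X" and b: "b \<in> Hom C X X"
  shows "(b \<cdot>\<^bsub>C\<^esub> twisted_act C \<xi> h a) \<cdot>\<^bsub>C\<^esub> \<xi> (h \<otimes> g)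
    = (b \<cdot>\<^bsub>C\<^esub> \<xi> h) \<cdot>\<^bsub>C\<^esub> actA C h (a \<cdot>\<^bsub>C\<^esub> \<xi> g)"
proof -
  have "(b \<cdot>\<^bsub>C\<^esub> twisted_act C \<xi> h a) \<cdot>\<^bsub>C\<^esub> \<xi> (h \<otimes> g)
      = ((b \<cdot>\<^bsub>C\<^esub> twisted_act C \<xi> h a) \<cdot>\<^bsub>C\<^esub> \<xi> h) \<cdot>\<^bsub>C\<^esub> actA C h (\<xi> g)"
    using assms by (intro comp_\<xi>_mult Comp_closed[OF twisted_act_Hom])
  also have "\<dots> = ((b \<cdot>\<^bsub>C\<^esub> \<xi> h) \<cdot>\<^bsub>C\<^esub> actA C h a) \<cdot>\<^bsub>C\<^esub> actA C h (\<xi> g)"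
    using assms by (simp add: twisted_act_comp_left)
  also have "\<dots> = (b \<cdot>\<^bsub>C\<^esub> \<xi> h) \<cdot>\<^bsub>C\<^esub> (actA C h a \<cdot>\<^bsub>C\<^esub> actA C h (\<xi> g))"
    using act_Hom[OF h \<xi>_Hom[OF g]] act_Hom[OF h a] Comp_closed[OF \<xi>_Hom[OF h] b]
    by (intro Comp_assoc)
  also have "actA C h a \<cdot>\<^bsub>C\<^esub> actA C h (\<xi> g) = actA C h (a \<cdot>\<^bsub>C\<^esub> \<xi> g)"
    using h \<xi>_Hom[OF g] a by (intro act_Comp[symmetric])
  finally show ?thesis .
qed

lemma twisted_act_mult:
  assumes h: "h \<in> carrier G" and g: "g \<in> carrier G" and a: "a \<in> Hom C X X"
  shows "twisted_act C \<xi> (h \<otimes> g) a = twisted_act C \<xi> h (twisted_act C \<xi> g a)"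
proof (rule twisted_act_eqI)
  let ?t = "twisted_act C \<xi> h (twisted_act C \<xi> g a)"
  have t: "twisted_act C \<xi> g a \<in> Hom C X X" "?t \<in> Hom C X X"
    using assms by (simp_all add: twisted_act_Hom)
  then show "?t \<in> Hom C X X" by simp
  \<comment> \<open>The identity is inserted so that the preceding formula applies with b =
    1.\<close>
  have "?t \<cdot>\<^bsub>C\<^esub> \<xi> (h \<otimes> g) = (Id C X \<cdot>\<^bsub>C\<^esub> ?t) \<cdot>\<^bsub>C\<^esub> \<xi> (h \<otimes> g)"
    using t by (simp add: Id_left)
  also have "\<dots> = (Id C X \<cdot>\<^bsub>C\<^esub> \<xi> h) \<cdot>\<^bsub>C\<^esub> actA C h (twisted_act C \<xi> g a \<cdot>\<^bsub>C\<^esub> \<xi> g)"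
    using h g t Id_closed[OF X_Obj] by (intro twisted_act_comp_\<xi>_mult)
  also have "\<dots> = \<xi> h \<cdot>\<^bsub>C\<^esub> actA C h (\<xi> g \<cdot>\<^bsub>C\<^esub> actA C g a)"
    using g a Id_left[OF \<xi>_Hom[OF h]] by (simp add: twisted_act_comp)
  also have "\<dots> = \<xi> h \<cdot>\<^bsub>C\<^esub> (actA C h (\<xi> g) \<cdot>\<^bsub>C\<^esub> actA C h (actA C g a))"
    using act_Comp[OF h act_Hom[OF g a] \<xi>_Hom[OF g]] by simp
  also have "\<dots> = (\<xi> h \<cdot>\<^bsub>C\<^esub> actA C h (\<xi> g)) \<cdot>\<^bsub>C\<^esub> actA C h (actA C g a)"
    using act_Hom[OF h act_Hom[OF g a]] act_Hom[OF h \<xi>_Hom[OF g]] \<xi>_Hom[OF h]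
    by (intro Comp_assoc[symmetric])
  also have "\<dots> = \<xi> (h \<otimes> g) \<cdot>\<^bsub>C\<^esub> actA C (h \<otimes> g) a"
    using h g HomD(1)[OF a] by (simp add: \<xi>_mult actA_mult)
  finally show "?t \<cdot>\<^bsub>C\<^esub> \<xi> (h \<otimes> g) = \<xi> (h \<otimes> g) \<cdot>\<^bsub>C\<^esub> actA C (h \<otimes> g) a" .
qed (use assms in auto)

lemma category_End_twisted: "category E"
  by unfold_locales
    (auto simp: End_twisted_simps Id_closed X_Obj intro: Comp_closed Id_left Id_right Comp_assoc)

text \<open>Makes the general results on cocycles available with \<open>E\<close> as coefficients,
  notably \<open>category_Z1\<close> and \<open>cocycle_inverse\<close>.\<close>

lemma G_category_End_twisted: "G_category G E"
proof (intro G_category.intro G_category_axioms.intro)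
  show "group G" by (rule group_axioms)
  show "category E" by (rule category_End_twisted)
  fix g assume g: "g \<in> carrier G"
  show "cat_functor E E (actO E g) (actA E g)"
    using g
    by (intro cat_functor.intro cat_functor_axioms.intro category_End_twisted)
      (auto simp: End_twisted_simps twisted_act_Hom twisted_act_Id twisted_act_Comp)
qed (auto simp: End_twisted_simps twisted_act_one twisted_act_mult)

section \<open>Twisting as a bijection on cocycles\<close>

lemma End_cocycles_iff:
  "(u, \<phi>) \<in> cocycles G E \<longleftrightarrow> \<phi> \<in> carrier G \<rightarrow>\<^sub>E Hom C X X \<and> \<phi> \<one> = Id C X \<and>
     (\<forall>h \<in> carrier G. \<forall>g \<in> carrier G. \<phi> (h \<otimes> g) = \<phi> h \<cdot>\<^bsub>C\<^esub> twisted_act C \<xi> h (\<phi> g))"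
  by (simp add: cocycles_iff End_twisted_simps)

text \<open>The two multiplicativity equations differ by the factor
  \<open>\<xi> (h \<otimes> g)\<close>, which cancels, and the two unit equations by
  \<open>\<xi> \<one>\<close>, which is an identity. An equivalence is stated because surjectivity
  of the twist uses the forward direction.\<close>

lemma twist_cocycle_iff:
  assumes \<phi>: "\<phi> \<in> carrier G \<rightarrow>\<^sub>E Hom C X X"
  shows "twist (u, \<phi>) \<in> cocycles G C \<longleftrightarrow> (u, \<phi>) \<in> cocycles G E"
proof -
  have \<phi>H: "\<phi> g \<in> Hom C X X" if "g \<in> carrier G" for g
    using \<phi> that by auto
  have "(\<lambda>g \<in> carrier G. \<phi> g \<cdot>\<^bsub>C\<^esub> \<xi> g) \<in> (\<Pi>\<^sub>E g \<in> carrier G. Hom C (actO C g X) X)"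
    using Comp_closed[OF \<xi>_Hom \<phi>H] by auto
  moreover have "\<phi> \<one> \<cdot>\<^bsub>C\<^esub> \<xi> \<one> = Id C X \<longleftrightarrow> \<phi> \<one> = Id C X"
    using Id_right[OF \<phi>H[of \<one>]] by (simp add: \<xi>_one)
  moreover have "\<phi> (h \<otimes> g) \<cdot>\<^bsub>C\<^esub> \<xi> (h \<otimes> g) = (\<phi> h \<cdot>\<^bsub>C\<^esub> \<xi> h) \<cdot>\<^bsub>C\<^esub> actA C h (\<phi> g \<cdot>\<^bsub>C\<^esub> \<xi> g)
      \<longleftrightarrow> \<phi> (h \<otimes> g) = \<phi> h \<cdot>\<^bsub>C\<^esub> twisted_act C \<xi> h (\<phi> g)"
    if h: "h \<in> carrier G" and g: "g \<in> carrier G" for h g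
  proof -
    have "\<phi> h \<cdot>\<^bsub>C\<^esub> twisted_act C \<xi> h (\<phi> g) \<in> Hom C X X"
      using h g \<phi>H twisted_act_Hom Comp_closed by meson
    then show ?thesis
      using \<xi>_cancel[OF m_closed[OF h g] \<phi>H[OF m_closed[OF h g]]]
        twisted_act_comp_\<xi>_mult[OF h g \<phi>H[OF g] \<phi>H[OF h]] by metis
  qed
  ultimately show ?thesis
    using \<phi> X_Obj by (simp add: twist_cocycle_def cocycles_iff[of X] End_cocycles_iff)
qed

text \<open>Right cancellation recovers the values on the carrier; extensionality fixes them
  elsewhere, and the unit component carries no information.\<close>

lemma twist_inj_on: "inj_on twist (UNIV \<times> (carrier G \<rightarrow>\<^sub>E Hom C X X))"
proof (rule inj_onI)
  fix P Q :: "unit \<times> ('g \<Rightarrow> 'm)"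
  assume P: "P \<in> UNIV \<times> (carrier G \<rightarrow>\<^sub>E Hom C X X)"
    and Q: "Q \<in> UNIV \<times> (carrier G \<rightarrow>\<^sub>E Hom C X X)"
    and eq: "twist P = twist Q"
  have \<phi>: "snd P \<in> carrier G \<rightarrow>\<^sub>E Hom C X X" and \<psi>: "snd Q \<in> carrier G \<rightarrow>\<^sub>E Hom C X X"
    using P Q by (simp_all add: mem_Times_iff)
  have "snd P = snd Q"
  proof (rule PiE_ext[OF \<phi> \<psi>])
    fix g assume g: "g \<in> carrier G"
    have "snd (twist P) g = snd (twist Q) g"
      by (simp add: eq)
    then have "snd P g \<cdot>\<^bsub>C\<^esub> \<xi> g = snd Q g \<cdot>\<^bsub>C\<^esub> \<xi> g"
      using g by (simp add: twist_cocycle_def split: prod.splits)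
    then show "snd P g = snd Q g"
      using \<xi>_cancel[OF g PiE_mem[OF \<phi> g] PiE_mem[OF \<psi> g]] by blast
  qed
  then show "P = Q"
    by (simp add: prod_eq_iff)
qed

text \<open>The equation \<phi>(g)\<xi>(g) = \<eta>(g) forces \<phi>(g) = \<eta>(g)\<xi>(g)^{-1}.
  That this family is a cocycle over \<open>E\<close> is read off from its twist \<eta> by
  \<open>twist_cocycle_iff\<close>.\<close>

lemma twist_surj:
  assumes \<eta>: "(X, \<eta>) \<in> cocycles G C"
  obtains \<phi> where "((), \<phi>) \<in> cocycles G E" "twist ((), \<phi>) = (X, \<eta>)"
proof -
  define \<phi> where "\<phi> = (\<lambda>g \<in> carrier G. \<eta> g \<cdot>\<^bsub>C\<^esub> inv_arrow C (\<xi> g))"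
  have \<phi>: "\<phi> \<in> carrier G \<rightarrow>\<^sub>E Hom C X X"
    unfolding \<phi>_def using Comp_closed[OF \<xi>_inv_Hom cocycle_Hom[OF \<eta>]] by auto
  have "(\<lambda>g \<in> carrier G. \<phi> g \<cdot>\<^bsub>C\<^esub> \<xi> g) = \<eta>"
  proof (rule extensionalityI)
    show "\<eta> \<in> extensional (carrier G)"
      using \<eta> by (auto simp: cocycles_iff PiE_def)
    show "(\<lambda>g \<in> carrier G. \<phi> g \<cdot>\<^bsub>C\<^esub> \<xi> g) g = \<eta> g" if "g \<in> carrier G" for g
      using that comp_inverse_cancel[OF \<xi>_Hom \<xi>_inv cocycle_Hom[OF \<eta>]] by (simp add: \<phi>_def)
  qed simp
  then have "twist ((), \<phi>) = (X, \<eta>)"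
    by (simp add: twist_cocycle_def)
  with \<phi> \<eta> twist_cocycle_iff that show thesis by metis
qed

lemma bij_betw_twist: "bij_betw twist (cocycles G E) (Obj (Z1_at G C X))"
proof -
  have Obj_at: "Obj (Z1_at G C X) = {P \<in> cocycles G C. fst P = X}"
    by (auto simp: Z1_at_def full_subcategory_def Obj_Z1)
  have sub: "cocycles G E \<subseteq> UNIV \<times> (carrier G \<rightarrow>\<^sub>E Hom C X X)"
    by (auto simp: End_cocycles_iff)
  have "twist P \<in> Obj (Z1_at G C X)" if "P \<in> cocycles G E" for P
    using that twist_cocycle_iff[of "snd P" "fst P"] sub
    by (cases P) (auto simp: Obj_at twist_cocycle_def)
  moreover have "Q \<in> twist ` cocycles G E" if "Q \<in> Obj (Z1_at G C X)" for Q
    using that twist_surj[of "snd Q"] unfolding Obj_at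
    by (metis (mono_tags, lifting) imageI mem_Collect_eq prod.collapse)
  ultimately show ?thesis
    unfolding bij_betw_def using inj_on_subset[OF twist_inj_on sub] by blast
qed

section \<open>Morphisms and the isomorphism of categories\<close>

text \<open>Composing the morphism equation over \<open>E\<close> with \<open>\<xi> g\<close> gives
  the other one, and cancellation goes back. The hom-sets are thus literally equal, so twisting can
  leave underlying arrows alone.\<close>

lemma cocycle_maps_twist:
  assumes P: "P \<in> cocycles G E" and Q: "Q \<in> cocycles G E"
  shows "cocycle_maps G C (twist P) (twist Q) = cocycle_maps G E P Q"
proof -
  obtain \<phi> \<psi> where PQ: "P = ((), \<phi>)" "Q = ((), \<psi>)"
    by (metis old.unit.exhaust surj_pair)
  have H: "\<phi> g \<in> Hom C X X" "\<psi> g \<in> Hom C X X" if "g \<in> carrier G" for g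
    using P Q that unfolding PQ End_cocycles_iff by auto
  have "a \<cdot>\<^bsub>C\<^esub> (\<phi> g \<cdot>\<^bsub>C\<^esub> \<xi> g) = (\<psi> g \<cdot>\<^bsub>C\<^esub> \<xi> g) \<cdot>\<^bsub>C\<^esub> actA C g a
      \<longleftrightarrow> a \<cdot>\<^bsub>C\<^esub> \<phi> g = \<psi> g \<cdot>\<^bsub>C\<^esub> twisted_act C \<xi> g a"
    if a: "a \<in> Hom C X X" and g: "g \<in> carrier G" for a g
  proof -
    have "a \<cdot>\<^bsub>C\<^esub> \<phi> g \<in> Hom C X X" "\<psi> g \<cdot>\<^bsub>C\<^esub> twisted_act C \<xi> g a \<in> Hom C X X"
      using a g H twisted_act_Hom Comp_closed by meson+
    then show ?thesis
      using \<xi>_cancel[OF g] Comp_assoc[OF \<xi>_Hom[OF g] H(1)[OF g] a]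
        twisted_act_comp_left[OF g a H(2)[OF g]] by metis
  qed
  then show ?thesis
    by (auto simp: PQ cocycle_maps_iff twist_cocycle_def End_twisted_simps)
qed

lemma fst_twist: "fst (twist P) = X"
  by (simp add: twist_cocycle_def split: prod.splits)

lemma twist_cocycle_closed:
  assumes "P \<in> cocycles G E"
  shows "twist P \<in> cocycles G C"
  using assms bij_betw_twist
  by (auto simp: bij_betw_def Z1_at_def full_subcategory_def Obj_Z1)

text \<open>Functoriality is immediate because \<open>E\<close> has the composition and identity of
  \<open>C\<close> at X. Bijectivity on arrows combines the bijection on objects with equality of
  hom-sets.\<close>

lemma Z1_End_isomorphism:
  "cat_isomorphism (Z1 G E) (Z1_at G C X) twist (\<lambda>(P, a, Q). (twist P, a, twist Q))"
proof (rule cat_functor_bij_imp_isomorphism)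
  let ?FA = "\<lambda>(P, a, Q). (twist P, a, twist Q)"
  have Hom_at: "F \<in> Hom (Z1_at G C X) P Q \<longleftrightarrow> F \<in> Hom (Z1 G C) P Q \<and> fst P = X \<and> fst Q = X"
    for F P Q
    by (auto simp: Z1_at_def full_subcategory_def Hom_def)
  have at: "Id (Z1_at G C X) = Id (Z1 G C)" "Comp (Z1_at G C X) = Comp (Z1 G C)"
    by (simp_all add: Z1_at_def full_subcategory_def)
  have "category (Z1 G E)"
    by (rule G_category.category_Z1[OF G_category_End_twisted])
  moreover have "category (Z1_at G C X)"
    unfolding Z1_at_def by (rule category.category_full_subcategory[OF category_Z1])
  ultimately show "cat_functor (Z1 G E) (Z1_at G C X) twist ?FA"
  proof (intro cat_functor.intro cat_functor_axioms.intro)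
    fix P assume "P \<in> Obj (Z1 G E)"
    then show "twist P \<in> Obj (Z1_at G C X)"
      using bij_betw_twist by (auto simp: Obj_Z1 bij_betw_def)
  next
    fix F P Q assume "F \<in> Hom (Z1 G E) P Q"
    then show "?FA F \<in> Hom (Z1_at G C X) (twist P) (twist Q)"
      by (auto simp: Hom_at Hom_Z1_iff cocycle_maps_twist fst_twist twist_cocycle_closed)
  qed (auto simp: at Id_Z1 fst_twist End_twisted_simps Hom_Z1_iff Comp_Z1)
  show bij: "bij_betw twist (Obj (Z1 G E)) (Obj (Z1_at G C X))"
    using bij_betw_twist by (simp add: Obj_Z1)
  have "inj_on ?FA (Arr (Z1 G E))"
  proof (rule inj_onI)
    fix F F' assume "F \<in> Arr (Z1 G E)" "F' \<in> Arr (Z1 G E)" "?FA F = ?FA F'"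
    then show "F = F'"
      using bij_betw_imp_inj_on[OF bij_betw_twist]
      by (cases F; cases F') (simp add: Z1_def inj_on_eq_iff)
  qed
  moreover have "?FA ` Arr (Z1 G E) = Arr (Z1_at G C X)"
  proof (intro subset_antisym subsetI)
    fix F assume "F \<in> ?FA ` Arr (Z1 G E)"
    then show "F \<in> Arr (Z1_at G C X)"
      by (auto simp: Z1_at_def full_subcategory_def Z1_def cocycle_maps_twist fst_twist
          twist_cocycle_closed)
  next
    fix F assume "F \<in> Arr (Z1_at G C X)"
    then obtain P a Q where F: "F = (P, a, Q)" "a \<in> cocycle_maps G C P Q"
      and "P \<in> Obj (Z1_at G C X)" "Q \<in> Obj (Z1_at G C X)"
      by (auto simp: Z1_at_def full_subcategory_def Z1_def)
    \<comment> \<open>Only the endpoints have to be pulled back; the underlying arrow a is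
      kept.\<close>
    then obtain P' Q' where "P' \<in> cocycles G E" "P = twist P'" "Q' \<in> cocycles G E" "Q = twist Q'"
      using bij_betw_twist unfolding bij_betw_def by blast
    with F have "(P', a, Q') \<in> Arr (Z1 G E)" "F = ?FA (P', a, Q')"
      by (simp_all add: Z1_def cocycle_maps_twist)
    then show "F \<in> ?FA ` Arr (Z1 G E)" by blast
  qed
  ultimately show "bij_betw ?FA (Arr (Z1 G E)) (Arr (Z1_at G C X))"
    by (simp add: bij_betw_def)
qed

text \<open>An isomorphism and its inverse are the same pair of endomorphisms of X on both sides.
  The left side refers to all of \<open>Z1 G C\<close>, as the classes in \<open>H1_at\<close>
  do.\<close>

lemma isomorphic_twist_iff:
  assumes "P \<in> cocycles G E" "Q \<in> cocycles G E"
  shows "isomorphic (Z1 G C) (twist P) (twist Q) \<longleftrightarrow> isomorphic (Z1 G E) P Q"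
  using assms
  by (simp add: isomorphic_Z1_iff cocycle_maps_twist twist_cocycle_closed fst_twist
      End_twisted_simps)

section \<open>From endomorphisms to automorphisms\<close>

text \<open>Invertibility of cocycle components, applied inside \<open>E\<close>, places all values
  among the units. The converse inclusion holds since units are endomorphisms and the operations
  agree.\<close>

lemma cocycles_Aut_twisted: "cocycles G (Aut_twisted C X \<xi>) = cocycles G E"
proof -
  interpret E: G_category G E by (rule G_category_End_twisted)
  have "\<phi> g \<in> Units (End_monoid C X)" if "(u, \<phi>) \<in> cocycles G E" "g \<in> carrier G" for u \<phi> g
    using E.cocycle_inverse[OF that] E.cocycle_Hom[OF that]
    by (auto simp: inverse_arrows_def Units_End_monoid_iff End_twisted_simps)
  then show ?thesis
    unfolding set_eq_iff split_paired_All
    by (fastforce simp: cocycles_iff Aut_twisted_simps End_twisted_simps PiE_def Pi_def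
        Units_End_monoid_iff)
qed

text \<open>The two arrows witnessing an isomorphism over \<open>E\<close> are mutually inverse
  endomorphisms of X, hence both are units.\<close>

lemma isomorphic_Aut_twisted_iff:
  "isomorphic (Z1 G (Aut_twisted C X \<xi>)) P Q \<longleftrightarrow> isomorphic (Z1 G E) P Q"
  unfolding isomorphic_Z1_iff
  by (auto simp: cocycles_Aut_twisted cocycle_maps_iff Aut_twisted_simps End_twisted_simps
      Units_End_monoid_iff Bex_def)

text \<open>A genuine equality of sets: \<open>iso_class\<close> depends only on the objects and on
  the relation \<open>isomorphic\<close>, and both coincide.\<close>

lemma H1_Aut_twisted: "H1 G (Aut_twisted C X \<xi>) = H1 G E"
  by (simp add: H1_def iso_class_def Obj_Z1 cocycles_Aut_twisted isomorphic_Aut_twisted_iff)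

end

theorem proposition1p4:
  fixes G :: "('g, 'y) monoid_scheme"
    and C :: "('g, 'o, 'm, 'z) gcat_scheme"
    and X :: 'o and \<xi> :: "'g \<Rightarrow> 'm"
  assumes "group G"
    and "G_category G C"
    and "(X, \<xi>) \<in> Obj (Z1 G C)"
  shows "(\<exists>FA. cat_isomorphism (Z1 G (End_twisted C X \<xi>)) (Z1_at G C X) (twist_cocycle G C X \<xi>) FA) \<and>
    H1 G (Aut_twisted C X \<xi>) = H1 G (End_twisted C X \<xi>) \<and>
    (\<exists>\<Phi>. bij_betw \<Phi> (H1 G (End_twisted C X \<xi>)) (H1_at G C X) \<and>
      (\<forall>P \<in> Obj (Z1 G (End_twisted C X \<xi>)).
        \<Phi> (iso_class (Z1 G (End_twisted C X \<xi>)) P) = iso_class (Z1 G C) (twist_cocycle G C X \<xi> P)))"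
proof -
  interpret G_category_cocycle G C X \<xi>
    using assms by (simp add: G_category_cocycle_def G_category_cocycle_axioms_def Obj_Z1)
  obtain \<Phi> where "bij_betw \<Phi> (iso_class (Z1 G E) ` Obj (Z1 G E))
      (iso_class (Z1 G C) ` twist ` Obj (Z1 G E))"
    and \<Phi>: "\<And>P. P \<in> Obj (Z1 G E) \<Longrightarrow> \<Phi> (iso_class (Z1 G E) P) = iso_class (Z1 G C) (twist P)"
    by (rule bij_betw_iso_classes[of "Z1 G E" "Z1 G C" twist])
      (auto simp: Obj_Z1 isomorphic_twist_iff twist_cocycle_closed category_Z1
        G_category.category_Z1[OF G_category_End_twisted])
  \<comment> \<open>This identifies the target of \<Phi>, the classes of twisted cocycles, with
    \<open>H1_at G C X\<close>.\<close>
  moreover have "twist ` Obj (Z1 G E) = Obj (Z1_at G C X)"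
    using bij_betw_twist by (simp add: bij_betw_def Obj_Z1)
  ultimately have "bij_betw \<Phi> (H1 G E) (H1_at G C X)"
    by (simp add: H1_def H1_at_def)
  with \<Phi> Z1_End_isomorphism H1_Aut_twisted show ?thesis by blast
qed

end
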